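(* Let $n\geq 1$ and let $w\in F_n$ be a word in the free generators $x_1,\dots,x_n$. Then $w$ satisfies the local to global property in $F_k$ for every $k\geq 1$ if and only if $w$ satisfies the local to global property in $F_k$ for every $k\leq n$.
   Context: For a residually finite group $G$, its profinite completion $\hat G$ is the closure of the image of the (injective) diagonal map $G\to\prod_{i}H_i$, $g\mapsto(\pi_i(g))_i$, where $\pi_i:G\to H_i$ ranges over all surjections onto finite groups, each $H_i$ discrete and the product carrying the product topology; $G$ is identified with a dense subgroup of $\hat G$. Free groups are residually finite. For a word $w\in F_n$ and elements $a_1,\dots,a_n$ of a group $\Gamma$, $w(a_1,\dots,a_n)$ denotes the image of $w$ under the homomorphism $F_n\to\Gamma$, $x_i\mapsto a_i$. We say that $w$ satisfies the local to global property in $F_k$ if for every $g\in F_k$: there exist $\hat g_1,\dots,\hat g_n\in\hat F_k$ with $w(\hat g_1,\dots,\hat g_n)=g$ if and only if there exist $g_1,\dots,g_n\in F_k$ with $w(g_1,\dots,g_n)=g$. *)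

theory Defs
  imports "HOL-Analysis.Analysis" "HOL-Algebra.Algebra"
begin

(* Letters: (i, False) = x_i, (i, True) = x_i^{-1}; generators indexed from 0. *)
type_synonym letter = "nat \<times> bool"

definition reduced :: "letter list \<Rightarrow> bool" where
  "reduced xs \<longleftrightarrow> (\<forall>i. Suc i < length xs \<longrightarrow>
      \<not> (fst (xs ! i) = fst (xs ! Suc i) \<and> snd (xs ! i) \<noteq> snd (xs ! Suc i)))"

fun red :: "letter list \<Rightarrow> letter list" where
  "red [] = []"
| "red (a # xs) = (case red xs of
       [] \<Rightarrow> [a]
     | b # ys \<Rightarrow> (if fst a = fst b \<and> snd a \<noteq> snd b then ys else a # b # ys))"

definition free_grp :: "nat \<Rightarrow> letter list monoid" where
  "free_grp k = \<lparr> carrier = {xs. set xs \<subseteq> {0..<k} \<times> UNIV \<and> reduced xs},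
                  mult = (\<lambda>xs ys. red (xs @ ys)),
                  one = [] \<rparr>"

definition word_eval :: "('g, 'm) monoid_scheme \<Rightarrow> letter list \<Rightarrow> (nat \<Rightarrow> 'g) \<Rightarrow> 'g" where
  "word_eval G w a = foldr (\<lambda>(i, b) acc. (if b then inv\<^bsub>G\<^esub> (a i) else a i) \<otimes>\<^bsub>G\<^esub> acc) w \<one>\<^bsub>G\<^esub>"

(* Kernels of surjections onto finite groups = finite-index normal subgroups. *)
definition fin_quot_idx :: "('g, 'm) monoid_scheme \<Rightarrow> 'g set set" where
  "fin_quot_idx G = {N. N \<lhd> G \<and> finite (carrier (G Mod N))}"

definition diag_map :: "('g, 'm) monoid_scheme \<Rightarrow> 'g \<Rightarrow> ('g set \<Rightarrow> 'g set)" where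
  "diag_map G g = (\<lambda>N\<in>fin_quot_idx G. N #>\<^bsub>G\<^esub> g)"

definition quot_prod_top :: "('g, 'm) monoid_scheme \<Rightarrow> ('g set \<Rightarrow> 'g set) topology" where
  "quot_prod_top G = product_topology (\<lambda>N. discrete_topology (carrier (G Mod N))) (fin_quot_idx G)"

definition profinite :: "('g, 'm) monoid_scheme \<Rightarrow> ('g set \<Rightarrow> 'g set) monoid" where
  "profinite G = \<lparr> carrier = quot_prod_top G closure_of (diag_map G ` carrier G),
                   mult = (\<lambda>x y. \<lambda>N\<in>fin_quot_idx G. x N \<otimes>\<^bsub>G Mod N\<^esub> y N),
                   one = (\<lambda>N\<in>fin_quot_idx G. \<one>\<^bsub>G Mod N\<^esub>) \<rparr>"

definition local_to_global :: "nat \<Rightarrow> letter list \<Rightarrow> nat \<Rightarrow> bool" where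
  "local_to_global n w k \<longleftrightarrow>
     (\<forall>g \<in> carrier (free_grp k).
        (\<exists>a. (\<forall>i<n. a i \<in> carrier (profinite (free_grp k))) \<and>
             word_eval (profinite (free_grp k)) w a = diag_map (free_grp k) g)
        \<longleftrightarrow>
        (\<exists>a. (\<forall>i<n. a i \<in> carrier (free_grp k)) \<and> word_eval (free_grp k) w a = g))"

end

theory Submission
  imports Defs
begin

text \<open>
  By compactness, \<open>g\<close> is a value of \<open>w\<close> in the profinite completion of \<open>F_m\<close> iff it is a value of
  \<open>w\<close> in every finite quotient. Suppose this holds and \<open>m > n\<close>. If some letter does not occur in \<open>g\<close>,
  killing it replaces \<open>m\<close> by \<open>m - 1\<close>. Otherwise, for each finite quotient some non-zero
  homomorphism from \<open>F_m\<close> to the group of order two vanishes on the \<open>n\<close> witnesses, and as there are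
  only finitely many such homomorphisms, one of them works for all quotients. Its kernel \<open>V\<close> contains
  \<open>g\<close>, and \<open>g\<close> is a value of \<open>w\<close> in every finite quotient of the free group \<open>V\<close>. As \<open>g\<close> involves
  every letter, it traverses an edge joining the two vertices of the covering graph of \<open>V\<close>;
  collapsing that edge gives a basis of \<open>V\<close> in which \<open>g\<close> is strictly shorter than before. So one
  concludes by induction on the length of \<open>g\<close> and then on \<open>m\<close>. Neither the freeness of \<open>V\<close> nor
  the injectivity of the rewriting is required: a homomorphism from \<open>V\<close> to a free group with a
  map back that fixes \<open>g\<close> is enough.
\<close>

section \<open>The free group on reduced words\<close>

lemma reduced_Nil [simp]: "reduced []"
  by (simp add: reduced_def)

lemma reduced_Cons:
  "reduced (a # xs) \<longleftrightarrow> reduced xs \<and> (xs = [] \<or> \<not> (fst a = fst (hd xs) \<and> snd a \<noteq> snd (hd xs)))"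
proof (cases xs)
  case (Cons b ys)
  have "(\<forall>i. P i) \<longleftrightarrow> P 0 \<and> (\<forall>i. P (Suc i))" for P
    by (metis not0_implies_Suc)
  from this[of "\<lambda>i. Suc i < length (a # xs) \<longrightarrow>
      \<not> (fst ((a # xs) ! i) = fst ((a # xs) ! Suc i) \<and> snd ((a # xs) ! i) \<noteq> snd ((a # xs) ! Suc i))"]
  show ?thesis
    unfolding reduced_def using Cons by auto
qed (simp add: reduced_def)

text \<open>Left multiplication of a reduced word by one letter; \<open>red\<close> is its fold, so
  the group laws can be proved letter by letter.\<close>

definition push :: "letter \<Rightarrow> letter list \<Rightarrow> letter list" where
  "push a ys = (case ys of [] \<Rightarrow> [a]
     | b # zs \<Rightarrow> (if fst a = fst b \<and> snd a \<noteq> snd b then zs else a # b # zs))"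

lemma red_Cons: "red (a # xs) = push a (red xs)"
  by (simp add: push_def)

declare red.simps(2) [simp del] red_Cons [simp]

definition flip :: "letter \<Rightarrow> letter" where
  "flip a = (fst a, \<not> snd a)"

lemma flip_simps [simp]: "flip (x, b) = (x, \<not> b)" "flip (flip a) = a" "fst (flip a) = fst a"
  by (auto simp: flip_def)

lemma push_cases:
  obtains (cancel) zs where "ys = flip a # zs" "push a ys = zs"
  | (keep) "push a ys = a # ys"
proof (cases ys)
  case Nil
  then show ?thesis using keep by (auto simp: push_def)
next
  case (Cons b zs)
  show ?thesis
  proof (cases "b = flip a")
    case True
    then show ?thesis using Cons cancel by (simp add: push_def flip_def)
  next
    case False
    then have "push a ys = a # ys"
      using Cons by (auto simp: push_def flip_def prod_eq_iff)
    then show ?thesis by (rule keep)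
  qed
qed

lemma reduced_push: "reduced ys \<Longrightarrow> reduced (push a ys)"
  by (cases ys) (auto simp: push_def reduced_Cons)

lemma reduced_red [simp]: "reduced (red xs)"
  by (induction xs) (auto simp: reduced_push)

lemma red_reduced [simp]: "reduced xs \<Longrightarrow> red xs = xs"
  by (induction xs) (auto simp: reduced_Cons push_def split: list.splits)

text \<open>Opposite letters act on reduced words by inverse bijections: if \<open>flip a\<close>
  cancels the head \<open>a\<close> of \<open>ys\<close>, reducedness keeps the returning
  \<open>a\<close> from cancelling with the next letter. This is van der Waerden's route to
  associativity.\<close>

lemma push_flip: "reduced ys \<Longrightarrow> push a (push (flip a) ys) = ys"
  by (cases ys; cases a) (auto simp: push_def reduced_Cons split: list.splits)

lemma red_append_red_right [simp]: "red (xs @ red ys) = red (xs @ ys)"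
  by (induction xs) auto

text \<open>With its counterpart on the right, this makes multiplication associative. Where
  \<open>a\<close> cancels against \<open>red xs\<close>, it cancels just as well after
  \<open>ys\<close> is appended, by \<open>push_flip\<close>.\<close>

lemma red_append_red_left [simp]: "red (red xs @ ys) = red (xs @ ys)"
proof (induction xs)
  case (Cons a xs)
  show ?case
  proof (cases rule: push_cases[where a = a and ys = "red xs"])
    case (cancel zs)
    then have "push a (red (xs @ ys)) = push a (push (flip a) (red (zs @ ys)))"
      using Cons by simp
    then show ?thesis
      using cancel by (simp add: push_flip)
  qed (use Cons in simp)
qed simp

lemma set_red: "set (red xs) \<subseteq> set xs"
  by (induction xs) (fastforce simp: push_def split: list.splits if_splits)+

lemma length_red: "length (red xs) \<le> length xs"
  by (induction xs) (auto simp: push_def split: list.splits if_splits)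

lemma red_rev_flip: "red (rev (map flip xs) @ xs) = []"
proof (induction xs)
  case (Cons a xs)
  have "red (flip a # a # xs) = red xs"
    using push_flip[of "red xs" "flip a"] by simp
  then have "red (rev (map flip xs) @ flip a # a # xs) = red (rev (map flip xs) @ xs)"
    by (metis red_append_red_right)
  then show ?case
    using Cons by simp
qed simp

lemma carrier_free_grp:
  "xs \<in> carrier (free_grp k) \<longleftrightarrow> set xs \<subseteq> {0..<k} \<times> UNIV \<and> reduced xs"
  by (simp add: free_grp_def)

lemma mult_free_grp [simp]: "xs \<otimes>\<^bsub>free_grp k\<^esub> ys = red (xs @ ys)"
  by (simp add: free_grp_def)

lemma one_free_grp [simp]: "\<one>\<^bsub>free_grp k\<^esub> = []"
  by (simp add: free_grp_def)

lemma red_in_free_grp: "set xs \<subseteq> {0..<k} \<times> UNIV \<Longrightarrow> red xs \<in> carrier (free_grp k)"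
  using set_red[of xs] by (auto simp: carrier_free_grp)

lemma group_free_grp: "group (free_grp k)"
proof (rule groupI)
  fix xs assume xs: "xs \<in> carrier (free_grp k)"
  have "red (rev (map flip xs)) \<in> carrier (free_grp k)"
    using xs by (intro red_in_free_grp) (auto simp: carrier_free_grp)
  then show "\<exists>y\<in>carrier (free_grp k). y \<otimes>\<^bsub>free_grp k\<^esub> xs = \<one>\<^bsub>free_grp k\<^esub>"
    by (intro bexI[of _ "red (rev (map flip xs))"]) (simp_all add: red_rev_flip)
next
  fix xs ys assume "xs \<in> carrier (free_grp k)" "ys \<in> carrier (free_grp k)"
  then show "xs \<otimes>\<^bsub>free_grp k\<^esub> ys \<in> carrier (free_grp k)"
    by (simp only: mult_free_grp) (rule red_in_free_grp, simp add: carrier_free_grp)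
qed (auto simp: carrier_free_grp)

lemma inv_free_grp_letter: "x < k \<Longrightarrow> inv\<^bsub>free_grp k\<^esub> [(x, b)] = [(x, \<not> b)]"
  by (rule group.inv_equality[OF group_free_grp]) (auto simp: carrier_free_grp push_def reduced_Cons)

section \<open>Word maps, finite quotients and the profinite completion\<close>

lemma word_eval_Nil [simp]: "word_eval G [] a = \<one>\<^bsub>G\<^esub>"
  by (simp add: word_eval_def)

lemma word_eval_Cons [simp]:
  "word_eval G ((i, b) # w) a = (if b then inv\<^bsub>G\<^esub> (a i) else a i) \<otimes>\<^bsub>G\<^esub> word_eval G w a"
  by (simp add: word_eval_def)

lemma word_eval_in_subgroup:
  assumes "group G" "subgroup V G" "\<And>i. i \<in> fst ` set w \<Longrightarrow> a i \<in> V"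
  shows "word_eval G w a \<in> V"
  using assms(3)
proof (induction w)
  case (Cons l w)
  then show ?case
    using assms(1,2) by (cases l) (auto intro: subgroup.m_closed subgroup.m_inv_closed)
qed (simp add: assms subgroup.one_closed)

lemma word_eval_closed:
  assumes "group G" "\<And>i. i \<in> fst ` set w \<Longrightarrow> a i \<in> carrier G"
  shows "word_eval G w a \<in> carrier G"
  using word_eval_in_subgroup[OF assms(1) group.subgroup_self] assms by blast

lemma word_eval_cong:
  "(\<And>i. i \<in> fst ` set w \<Longrightarrow> a i = b i) \<Longrightarrow> word_eval G w a = word_eval G w b"
  by (induction w) force+

text \<open>Stated on a subgroup because Schreier rewriting will be a homomorphism only on the words
  of even parity.\<close>

lemma hom_on_subgroup_word_eval:
  assumes G: "group G" and H: "group H" and V: "subgroup V G"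
    and h: "h \<in> hom (G\<lparr>carrier := V\<rparr>) H"
    and a: "\<And>i. i \<in> fst ` set w \<Longrightarrow> a i \<in> V"
  shows "h (word_eval G w a) = word_eval H w (\<lambda>i. h (a i))"
  using a
proof (induction w)
  case Nil
  have "group_hom (G\<lparr>carrier := V\<rparr>) H h"
    using assms by (simp add: group_hom_def group_hom_axioms_def subgroup.subgroup_is_group)
  from group_hom.hom_one[OF this] show ?case
    by simp
next
  case (Cons l w)
  obtain i b where l: "l = (i, b)"
    by (cases l)
  have gh: "group_hom (G\<lparr>carrier := V\<rparr>) H h"
    using assms by (simp add: group_hom_def group_hom_axioms_def subgroup.subgroup_is_group)
  have ai: "a i \<in> V" and inv_ai: "inv\<^bsub>G\<^esub> (a i) \<in> V"
    using Cons.prems l V by (auto intro: subgroup.m_inv_closed)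
  have "word_eval G w a \<in> V"
    using word_eval_in_subgroup[OF G V] Cons.prems by simp
  moreover have "h (inv\<^bsub>G\<^esub> (a i)) = inv\<^bsub>H\<^esub> (h (a i))"
    using group_hom.hom_inv[OF gh, of "a i"] ai group.m_inv_consistent[OF G V ai] by simp
  ultimately show ?case
    using Cons ai inv_ai h by (simp add: l hom_def Pi_iff)
qed

lemma hom_word_eval:
  assumes "group G" "group H" "h \<in> hom G H" "\<And>i. i \<in> fst ` set w \<Longrightarrow> a i \<in> carrier G"
  shows "h (word_eval G w a) = word_eval H w (\<lambda>i. h (a i))"
  using hom_on_subgroup_word_eval[OF assms(1,2) group.subgroup_self[OF assms(1)]] assms by simp

lemma fst_set_free_grp: "w \<in> carrier (free_grp n) \<Longrightarrow> i \<in> fst ` set w \<Longrightarrow> i < n"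
  by (auto simp: free_grp_def)

section \<open>Normal subgroups of finite index and their cosets\<close>

lemma finite_image_factor:
  assumes "finite (f ` A)" "\<And>x y. x \<in> A \<Longrightarrow> y \<in> A \<Longrightarrow> f x = f y \<Longrightarrow> g x = g y"
  shows "finite (g ` A)"
proof (rule finite_subset)
  show "g ` A \<subseteq> (\<lambda>b. g (inv_into A f b)) ` f ` A"
  proof
    fix y assume "y \<in> g ` A"
    then obtain x where x: "x \<in> A" "y = g x"
      by blast
    then have "g (inv_into A f (f x)) = g x"
      by (intro assms(2)) (simp_all add: f_inv_into_f inv_into_into)
    then show "y \<in> (\<lambda>b. g (inv_into A f b)) ` f ` A"
      using x by (metis imageI)
  qed
qed (use assms in simp)

lemma (in group) rcos_eq_iff:
  assumes "subgroup N G" "x \<in> carrier G" "y \<in> carrier G"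
  shows "N #> x = N #> y \<longleftrightarrow> x \<otimes> inv y \<in> N"
  using assms by (metis is_group repr_independence repr_independenceD subgroup.rcos_module)

lemma carrier_Mod: "carrier (G Mod N) = (\<lambda>x. N #>\<^bsub>G\<^esub> x) ` carrier G"
  by (auto simp: FactGroup_def RCOSETS_def)

lemma mult_Mod [simp]: "x \<otimes>\<^bsub>G Mod N\<^esub> y = x <#>\<^bsub>G\<^esub> y"
  by (simp add: FactGroup_def)

lemma one_Mod [simp]: "\<one>\<^bsub>G Mod N\<^esub> = N"
  by (simp add: FactGroup_def)

lemma fin_quot_idx_normal: "N \<in> fin_quot_idx G \<Longrightarrow> N \<lhd> G"
  and fin_quot_idx_finite: "N \<in> fin_quot_idx G \<Longrightarrow> finite (carrier (G Mod N))"
  by (auto simp: fin_quot_idx_def)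

lemma fin_quot_idx_subgroup: "N \<in> fin_quot_idx G \<Longrightarrow> subgroup N G"
  by (simp add: fin_quot_idx_normal normal_imp_subgroup)

context group
begin

text \<open>Finite index is certified by any map with finitely many values that separates the cosets
  of \<open>N\<close>.\<close>

lemma fin_quot_idxI:
  assumes "N \<lhd> G" "finite (f ` carrier G)"
    and "\<And>x y. x \<in> carrier G \<Longrightarrow> y \<in> carrier G \<Longrightarrow> f x = f y \<Longrightarrow> x \<otimes> inv y \<in> N"
  shows "N \<in> fin_quot_idx G"
  using assms finite_image_factor[of f "carrier G" "\<lambda>x. N #> x"]
  by (simp add: fin_quot_idx_def carrier_Mod rcos_eq_iff normal_imp_subgroup)

lemma carrier_in_fin_quot_idx: "carrier G \<in> fin_quot_idx G"
  by (rule fin_quot_idxI[where f = "\<lambda>_. ()"]) (auto simp: normal_inv_iff subgroup_self)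

lemma fin_quot_idx_Int:
  assumes "N \<in> fin_quot_idx G" "M \<in> fin_quot_idx G"
  shows "N \<inter> M \<in> fin_quot_idx G"
proof (rule fin_quot_idxI[where f = "\<lambda>x. (N #> x, M #> x)"])
  show "N \<inter> M \<lhd> G"
    using assms by (simp add: fin_quot_idx_normal normal_subgroup_intersect)
  have "(\<lambda>x. (N #> x, M #> x)) ` carrier G \<subseteq> carrier (G Mod N) \<times> carrier (G Mod M)"
    by (auto simp: carrier_Mod)
  then show "finite ((\<lambda>x. (N #> x, M #> x)) ` carrier G)"
    using assms by (meson fin_quot_idx_finite finite_SigmaI finite_subset)
qed (use assms in \<open>auto simp: rcos_eq_iff fin_quot_idx_subgroup\<close>)

text \<open>The family is closed under intersection, hence directed downwards; the whole group
  serves the empty subfamily.\<close>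

lemma fin_quot_idx_lower_bound:
  assumes "finite \<K>" "\<K> \<subseteq> fin_quot_idx G"
  obtains N where "N \<in> fin_quot_idx G" "\<And>M. M \<in> \<K> \<Longrightarrow> N \<subseteq> M"
proof -
  have "\<exists>N\<in>fin_quot_idx G. \<forall>M\<in>\<K>. N \<subseteq> M"
    using assms
  proof (induction \<K>)
    case empty
    then show ?case using carrier_in_fin_quot_idx by blast
  next
    case (insert M \<K>)
    then obtain N where "N \<in> fin_quot_idx G" "\<forall>M\<in>\<K>. N \<subseteq> M"
      by blast
    then show ?case
      using insert.prems by (intro bexI[of _ "M \<inter> N"]) (auto intro: fin_quot_idx_Int)
  qed
  then show ?thesis using that by blast
qed

lemma rcos_eq_mono:
  assumes "N #> x = N #> y" "N \<subseteq> M" "subgroup N G" "subgroup M G" "x \<in> carrier G" "y \<in> carrier G"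
  shows "M #> x = M #> y"
  using assms by (auto simp: rcos_eq_iff)

section \<open>The profinite completion as the group of coherent coset families\<close>

lemma topspace_quot_prod_top:
  "topspace (quot_prod_top G) = (\<Pi>\<^sub>E N\<in>fin_quot_idx G. carrier (G Mod N))"
  by (simp add: quot_prod_top_def)

text \<open>Coherence involves only two coordinates: the basic neighbourhood of \<open>x\<close>
  that fixes the coordinates \<open>N\<close> and \<open>M\<close> contains a diagonal point, for
  which it is evident.\<close>

lemma profinite_memD:
  assumes x: "x \<in> carrier (profinite G)" and NM: "N \<in> fin_quot_idx G" "M \<in> fin_quot_idx G" "N \<subseteq> M"
  shows "x N \<subseteq> x M"
proof -
  let ?U = "\<Pi>\<^sub>E K\<in>fin_quot_idx G. if K = N \<or> K = M then {x K} else carrier (G Mod K)"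
  have cl: "x \<in> quot_prod_top G closure_of (diag_map G ` carrier G)"
    using x by (simp add: profinite_def)
  then have xt: "x \<in> (\<Pi>\<^sub>E N\<in>fin_quot_idx G. carrier (G Mod N))"
    by (metis in_closure_of topspace_quot_prod_top)
  have "finite {K \<in> fin_quot_idx G. (if K = N \<or> K = M then {x K} else carrier (G Mod K)) \<noteq> carrier (G Mod K)}"
    by (rule finite_subset[of _ "{N, M}"]) auto
  moreover have "\<forall>K\<in>fin_quot_idx G. (if K = N \<or> K = M then {x K} else carrier (G Mod K)) \<subseteq> carrier (G Mod K)"
    using xt by auto
  ultimately have "openin (quot_prod_top G) ?U"
    unfolding quot_prod_top_def openin_PiE_gen by simp
  moreover have "x \<in> ?U"
    using xt by (auto simp: PiE_iff)
  ultimately obtain u where u: "u \<in> carrier G" "diag_map G u \<in> ?U"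
    using cl by (auto simp: in_closure_of)
  from u(2) NM have "x N = N #> u" "x M = M #> u"
    by (auto simp: diag_map_def PiE_iff)
  then show ?thesis
    using NM by (auto simp: r_coset_def)
qed

text \<open>A basic neighbourhood constrains finitely many coordinates. For an \<open>N\<close>
  below all of them, a representative of \<open>x N\<close> represents \<open>x\<close> at each of
  them by coherence and so gives a diagonal point inside.\<close>

lemma profiniteI:
  assumes x: "x \<in> (\<Pi>\<^sub>E N\<in>fin_quot_idx G. carrier (G Mod N))"
    and mono: "\<And>N M. N \<in> fin_quot_idx G \<Longrightarrow> M \<in> fin_quot_idx G \<Longrightarrow> N \<subseteq> M \<Longrightarrow> x N \<subseteq> x M"
  shows "x \<in> carrier (profinite G)"
proof -
  have "\<exists>y\<in>diag_map G ` carrier G. y \<in> U" if U: "x \<in> U" "openin (quot_prod_top G) U" for U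
  proof -
    have "openin (product_topology (\<lambda>N. discrete_topology (carrier (G Mod N))) (fin_quot_idx G)) U"
      using U(2) by (simp add: quot_prod_top_def)
    from this[unfolded openin_product_topology_alt, rule_format, OF U(1)]
    obtain B where B: "finite {N \<in> fin_quot_idx G. B N \<noteq> carrier (G Mod N)}"
      "x \<in> Pi\<^sub>E (fin_quot_idx G) B" "Pi\<^sub>E (fin_quot_idx G) B \<subseteq> U"
      unfolding topspace_discrete_topology by (elim exE conjE)
    obtain N where N: "N \<in> fin_quot_idx G"
      "\<And>M. M \<in> {N \<in> fin_quot_idx G. B N \<noteq> carrier (G Mod N)} \<Longrightarrow> N \<subseteq> M"
      using fin_quot_idx_lower_bound[OF B(1)] by blast
    obtain u where u: "u \<in> carrier G" "x N = N #> u"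
      using x N(1) by (auto simp: PiE_iff carrier_Mod)
    have "diag_map G u M \<in> B M" if M: "M \<in> fin_quot_idx G" for M
    proof (cases "B M = carrier (G Mod M)")
      case False
      have "N \<subseteq> M"
        using False M by (intro N(2)) simp
      moreover have "u \<in> x N"
        using u N(1) by (simp add: rcos_self fin_quot_idx_subgroup)
      ultimately have "u \<in> x M"
        using mono[OF N(1) M] by blast
      moreover obtain v where v: "v \<in> carrier G" "x M = M #> v"
        using x M by (auto simp: PiE_iff carrier_Mod)
      ultimately have "M #> u = x M"
        using repr_independence M fin_quot_idx_subgroup by metis
      then show ?thesis
        using B(2) M by (auto simp: diag_map_def PiE_iff)
    qed (use u M in \<open>auto simp: diag_map_def carrier_Mod\<close>)
    then have "diag_map G u \<in> Pi\<^sub>E (fin_quot_idx G) B"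
      by (auto simp: diag_map_def PiE_iff)
    then show ?thesis
      using B(3) u(1) by blast
  qed
  then show ?thesis
    using x by (simp add: profinite_def in_closure_of topspace_quot_prod_top)
qed

lemma profinite_coset:
  assumes "x \<in> carrier (profinite G)" "N \<in> fin_quot_idx G"
  shows "x N \<in> carrier (G Mod N)"
proof -
  have "x \<in> topspace (quot_prod_top G)"
    using assms(1) by (simp add: profinite_def in_closure_of)
  then show ?thesis
    using assms(2) by (auto simp: topspace_quot_prod_top)
qed

text \<open>By coherence a representative at level \<open>N\<close> serves all coarser levels, so
  computations in the completion reduce to elements of \<open>G\<close>.\<close>

lemma profinite_rep:
  assumes "x \<in> carrier (profinite G)" "N \<in> fin_quot_idx G"
  obtains u where "u \<in> carrier G" "\<And>M. M \<in> fin_quot_idx G \<Longrightarrow> N \<subseteq> M \<Longrightarrow> x M = M #> u"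
proof -
  obtain u where u: "u \<in> carrier G" "x N = N #> u"
    using profinite_coset[OF assms] by (auto simp: carrier_Mod)
  have "x M = M #> u" if M: "M \<in> fin_quot_idx G" "N \<subseteq> M" for M
  proof -
    have "u \<in> x M"
      using profinite_memD[OF assms M] u rcos_self assms(2) fin_quot_idx_subgroup by blast
    moreover obtain v where "v \<in> carrier G" "x M = M #> v"
      using profinite_coset[OF assms(1) M(1)] by (auto simp: carrier_Mod)
    ultimately show ?thesis
      using repr_independence M fin_quot_idx_subgroup by metis
  qed
  then show ?thesis
    using that u(1) by blast
qed

lemma profiniteI_rep:
  assumes x: "x \<in> extensional (fin_quot_idx G)"
    and rep: "\<And>N M. N \<in> fin_quot_idx G \<Longrightarrow> M \<in> fin_quot_idx G \<Longrightarrow> N \<subseteq> M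
      \<Longrightarrow> \<exists>u\<in>carrier G. x N = N #> u \<and> x M = M #> u"
  shows "x \<in> carrier (profinite G)"
proof (rule profiniteI)
  show "x \<in> (\<Pi>\<^sub>E N\<in>fin_quot_idx G. carrier (G Mod N))"
    using x rep[OF _ _ order.refl] by (auto simp: PiE_iff carrier_Mod)
  show "x N \<subseteq> x M" if "N \<in> fin_quot_idx G" "M \<in> fin_quot_idx G" "N \<subseteq> M" for N M
    using rep[OF that] that(3) unfolding r_coset_def by blast
qed

lemma profinite_eqI:
  assumes "x \<in> carrier (profinite G)" "y \<in> carrier (profinite G)"
    and "\<And>N. N \<in> fin_quot_idx G \<Longrightarrow> x N = y N"
  shows "x = y"
proof -
  have "x \<in> extensional (fin_quot_idx G)" "y \<in> extensional (fin_quot_idx G)"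
    using assms(1,2) by (auto simp: profinite_def in_closure_of topspace_quot_prod_top PiE_iff)
  then show ?thesis
    using assms(3) by (rule extensionalityI)
qed

lemma mult_profinite:
  "N \<in> fin_quot_idx G \<Longrightarrow> (x \<otimes>\<^bsub>profinite G\<^esub> y) N = x N <#> y N"
  by (simp add: profinite_def)

lemma one_profinite: "N \<in> fin_quot_idx G \<Longrightarrow> \<one>\<^bsub>profinite G\<^esub> N = N"
  by (simp add: profinite_def)

lemma diag_map_in_profinite: "u \<in> carrier G \<Longrightarrow> diag_map G u \<in> carrier (profinite G)"
  by (rule profiniteI_rep) (auto simp: diag_map_def)

lemma mult_profinite_closed:
  assumes "x \<in> carrier (profinite G)" "y \<in> carrier (profinite G)"
  shows "x \<otimes>\<^bsub>profinite G\<^esub> y \<in> carrier (profinite G)"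
proof (rule profiniteI_rep)
  show "x \<otimes>\<^bsub>profinite G\<^esub> y \<in> extensional (fin_quot_idx G)"
    by (simp add: profinite_def)
next
  fix N M assume NM: "N \<in> fin_quot_idx G" "M \<in> fin_quot_idx G" "N \<subseteq> M"
  obtain u where u: "u \<in> carrier G" "\<And>M. M \<in> fin_quot_idx G \<Longrightarrow> N \<subseteq> M \<Longrightarrow> x M = M #> u"
    using profinite_rep[OF assms(1) NM(1)] by blast
  obtain v where v: "v \<in> carrier G" "\<And>M. M \<in> fin_quot_idx G \<Longrightarrow> N \<subseteq> M \<Longrightarrow> y M = M #> v"
    using profinite_rep[OF assms(2) NM(1)] by blast
  show "\<exists>u\<in>carrier G. (x \<otimes>\<^bsub>profinite G\<^esub> y) N = N #> u \<and> (x \<otimes>\<^bsub>profinite G\<^esub> y) M = M #> u"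
    using NM u v
    by (intro bexI[of _ "u \<otimes> v"]) (simp_all add: mult_profinite normal.rcos_sum fin_quot_idx_normal)
qed

lemma group_profinite: "group (profinite G)"
proof (rule groupI)
  have one: "\<one>\<^bsub>profinite G\<^esub> = diag_map G \<one>"
    by (auto simp: profinite_def diag_map_def fin_quot_idx_subgroup subgroup.subset coset_mult_one
        intro!: restrict_ext)
  then show oneG: "\<one>\<^bsub>profinite G\<^esub> \<in> carrier (profinite G)"
    by (simp add: diag_map_in_profinite)
  fix x assume x: "x \<in> carrier (profinite G)"
  have xN: "x N \<in> carrier (G Mod N)" if "N \<in> fin_quot_idx G" for N
    using profinite_coset x that by blast
  show "\<one>\<^bsub>profinite G\<^esub> \<otimes>\<^bsub>profinite G\<^esub> x = x"
  proof (rule profinite_eqI)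
    fix N assume N: "N \<in> fin_quot_idx G"
    interpret Q: group "G Mod N"
      using N by (simp add: normal.factorgroup_is_group fin_quot_idx_normal)
    show "(\<one>\<^bsub>profinite G\<^esub> \<otimes>\<^bsub>profinite G\<^esub> x) N = x N"
      using Q.l_one[OF xN[OF N]] N by (simp add: mult_profinite one_profinite)
  qed (use x oneG mult_profinite_closed in auto)
  show "\<exists>y\<in>carrier (profinite G). y \<otimes>\<^bsub>profinite G\<^esub> x = \<one>\<^bsub>profinite G\<^esub>"
  proof
    let ?y = "\<lambda>N\<in>fin_quot_idx G. inv\<^bsub>G Mod N\<^esub> (x N)"
    show y: "?y \<in> carrier (profinite G)"
    proof (rule profiniteI_rep)
      fix N M assume NM: "N \<in> fin_quot_idx G" "M \<in> fin_quot_idx G" "N \<subseteq> M"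
      obtain u where u: "u \<in> carrier G" "\<And>M. M \<in> fin_quot_idx G \<Longrightarrow> N \<subseteq> M \<Longrightarrow> x M = M #> u"
        using profinite_rep[OF x NM(1)] by blast
      have "inv\<^bsub>G Mod K\<^esub> (K #> u) = K #> inv u" if "K \<in> fin_quot_idx G" for K
      proof -
        have K: "K \<lhd> G"
          using that by (rule fin_quot_idx_normal)
        interpret h: group_hom G "G Mod K" "\<lambda>x. K #> x"
          using K normal.r_coset_hom_Mod by (simp add: group_hom_def group_hom_axioms_def
              normal.factorgroup_is_group is_group)
        show ?thesis
          using h.hom_inv[OF u(1)] by simp
      qed
      then show "\<exists>u\<in>carrier G. ?y N = N #> u \<and> ?y M = M #> u"
        using NM u by (intro bexI[of _ "inv u"]) auto
    qed simp
    show "?y \<otimes>\<^bsub>profinite G\<^esub> x = \<one>\<^bsub>profinite G\<^esub>"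
    proof (rule profinite_eqI)
      fix N assume N: "N \<in> fin_quot_idx G"
      interpret Q: group "G Mod N"
        using N by (simp add: normal.factorgroup_is_group fin_quot_idx_normal)
      show "(?y \<otimes>\<^bsub>profinite G\<^esub> x) N = \<one>\<^bsub>profinite G\<^esub> N"
        using Q.l_inv[OF xN[OF N]] N by (simp add: mult_profinite one_profinite)
    qed (use x y oneG mult_profinite_closed in auto)
  qed
  fix y z assume yz: "y \<in> carrier (profinite G)" "z \<in> carrier (profinite G)"
  show "x \<otimes>\<^bsub>profinite G\<^esub> y \<otimes>\<^bsub>profinite G\<^esub> z = x \<otimes>\<^bsub>profinite G\<^esub> (y \<otimes>\<^bsub>profinite G\<^esub> z)"
  proof (rule profinite_eqI)
    fix N assume N: "N \<in> fin_quot_idx G"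
    interpret Q: group "G Mod N"
      using N by (simp add: normal.factorgroup_is_group fin_quot_idx_normal)
    show "(x \<otimes>\<^bsub>profinite G\<^esub> y \<otimes>\<^bsub>profinite G\<^esub> z) N = (x \<otimes>\<^bsub>profinite G\<^esub> (y \<otimes>\<^bsub>profinite G\<^esub> z)) N"
      using Q.m_assoc[of "x N" "y N" "z N"] x yz N
      by (simp add: mult_profinite profinite_coset)
  qed (use x yz mult_profinite_closed in auto)
qed (rule mult_profinite_closed)

lemma hom_profinite_proj:
  "N \<in> fin_quot_idx G \<Longrightarrow> (\<lambda>x. x N) \<in> hom (profinite G) (G Mod N)"
  by (auto simp: hom_def profinite_coset mult_profinite)

end

section \<open>Values of words in all finite quotients\<close>

text \<open>The witnesses are chosen anew for each \<open>N\<close>; compactness will make them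
  compatible.\<close>

definition residual_value :: "('g, 'm) monoid_scheme \<Rightarrow> nat \<Rightarrow> letter list \<Rightarrow> 'g \<Rightarrow> bool" where
  "residual_value G n w g \<longleftrightarrow> (\<forall>N\<in>fin_quot_idx G. \<exists>a. (\<forall>i<n. a i \<in> carrier G) \<and>
     N #>\<^bsub>G\<^esub> word_eval G w a = N #>\<^bsub>G\<^esub> g)"

text \<open>The set is a finite union of boxes, one for each admissible value \<open>y\<close> of
  the coordinates in \<open>K\<close>, and each box is a product of closed sets.\<close>

lemma closedin_finite_coords:
  assumes K: "finite K" "K \<subseteq> I" "\<And>j. j \<in> K \<Longrightarrow> finite (F j)"
  shows "closedin (product_topology (\<lambda>j. discrete_topology (F j)) I)
           {x \<in> Pi\<^sub>E I F. Q (restrict x K)}" (is "closedin ?T ?C")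
proof -
  let ?box = "\<lambda>y. \<Pi>\<^sub>E j\<in>I. if j \<in> K then {y j} else F j"
  have "?C = \<Union> (?box ` {y \<in> Pi\<^sub>E K F. Q y})"
  proof (intro equalityI subsetI)
    fix x assume x: "x \<in> ?C"
    then have "x \<in> ?box (restrict x K)" "restrict x K \<in> {y \<in> Pi\<^sub>E K F. Q y}"
      using K(2) by (auto simp: PiE_iff)
    then show "x \<in> \<Union> (?box ` {y \<in> Pi\<^sub>E K F. Q y})"
      by blast
  next
    fix x assume "x \<in> \<Union> (?box ` {y \<in> Pi\<^sub>E K F. Q y})"
    then obtain y where y: "y \<in> Pi\<^sub>E K F" "Q y" and x: "x \<in> ?box y"
      by blast
    have eq: "x j = y j" if "j \<in> K" for j
      using PiE_mem[OF x, of j] that K(2) by auto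
    then have "restrict x K = y"
      using y(1) by (intro extensionalityI[of _ K]) (auto simp: PiE_iff)
    moreover have "x j \<in> F j" if "j \<in> I" for j
      using PiE_mem[OF x that] PiE_mem[OF y(1), of j] by (auto split: if_splits)
    then have "x \<in> Pi\<^sub>E I F"
      using x by (auto simp: PiE_iff)
    ultimately show "x \<in> ?C"
      using y(2) by simp
  qed
  moreover have "closedin ?T (?box y)" if "y \<in> Pi\<^sub>E K F" for y
    using that K(2) unfolding closedin_product_topology by (auto simp: PiE_iff)
  moreover have "finite {y \<in> Pi\<^sub>E K F. Q y}"
    using finite_PiE[of K F] K by simp
  ultimately show ?thesis
    by (auto intro!: closedin_Union)
qed

context group
begin

lemma rcos_word_eval:
  assumes "N \<in> fin_quot_idx G" "\<And>i. i \<in> fst ` set w \<Longrightarrow> a i \<in> carrier G"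
  shows "N #> word_eval G w a = word_eval (G Mod N) w (\<lambda>i. N #> a i)"
  using hom_word_eval[OF is_group _ normal.r_coset_hom_Mod] assms
  by (simp add: fin_quot_idx_normal normal.factorgroup_is_group)

lemma profinite_word_eval:
  assumes "N \<in> fin_quot_idx G" "\<And>i. i \<in> fst ` set w \<Longrightarrow> a i \<in> carrier (profinite G)"
  shows "word_eval (profinite G) w a N = word_eval (G Mod N) w (\<lambda>i. a i N)"
  using hom_word_eval[OF group_profinite _ hom_profinite_proj] assms
  by (simp add: fin_quot_idx_normal normal.factorgroup_is_group)

lemma residual_value_if_profinite_value:
  assumes w: "\<And>i. i \<in> fst ` set w \<Longrightarrow> i < n"
    and a: "\<And>i. i < n \<Longrightarrow> a i \<in> carrier (profinite G)"
    and eq: "word_eval (profinite G) w a = diag_map G g"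
  shows "residual_value G n w g"
  unfolding residual_value_def
proof
  fix N assume N: "N \<in> fin_quot_idx G"
  have "\<exists>u. u \<in> carrier G \<and> a i N = N #> u" if "i < n" for i
    by (rule profinite_rep[OF a[OF that] N]) (use N in auto)
  then obtain u where u: "\<And>i. i < n \<Longrightarrow> u i \<in> carrier G \<and> a i N = N #> u i"
    by metis
  have "N #> word_eval G w u = word_eval (G Mod N) w (\<lambda>i. N #> u i)"
    using u w by (intro rcos_word_eval N) simp
  also have "\<dots> = word_eval (G Mod N) w (\<lambda>i. a i N)"
    using u w by (intro word_eval_cong) simp
  also have "\<dots> = word_eval (profinite G) w a N"
    using a w N by (simp add: profinite_word_eval)
  also have "\<dots> = N #> g"
    using N by (simp add: eq diag_map_def)
  finally show "\<exists>a. (\<forall>i<n. a i \<in> carrier G) \<and> N #> word_eval G w a = N #> g"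
    using u by blast
qed

text \<open>The coset families that solve the equation on a finite set of levels form closed sets
  with the finite intersection property; by compactness some family lies in all of them.\<close>

lemma profinite_value_if_residual_value:
  assumes w: "\<And>i. i \<in> fst ` set w \<Longrightarrow> i < n" and g: "g \<in> carrier G"
    and res: "residual_value G n w g"
  obtains a where "\<And>i. i < n \<Longrightarrow> a i \<in> carrier (profinite G)"
    "word_eval (profinite G) w a = diag_map G g"
proof -
  define I where "I = {..<n} \<times> fin_quot_idx G"
  define F where "F = (\<lambda>(i::nat, N). carrier (G Mod N))"
  define T where "T = product_topology (\<lambda>j. discrete_topology (F j)) I"
  \<comment> \<open>One tuple \<open>u\<close> has to serve all levels in \<open>\<K>\<close> at
    once: two-element sets \<open>\<K>\<close> will then give coherence, and singletons the
    equation.\<close>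
  define good where "good \<K> x u \<longleftrightarrow> (\<forall>i<n. u i \<in> carrier G) \<and>
      (\<forall>N\<in>\<K>. N #> word_eval G w u = N #> g \<and> (\<forall>i<n. x (i, N) = N #> u i))" for \<K> x u
  define E where "E \<K> = {x \<in> Pi\<^sub>E I F. \<exists>u. good \<K> (restrict x ({..<n} \<times> \<K>)) u}" for \<K>
  have E_iff: "x \<in> E \<K> \<longleftrightarrow> x \<in> Pi\<^sub>E I F \<and> (\<exists>u. good \<K> x u)" for x \<K>
    by (simp add: E_def good_def)
  define \<C> where "\<C> = E ` {\<K>. finite \<K> \<and> \<K> \<subseteq> fin_quot_idx G}"
  have finF: "finite (F j)" if "j \<in> I" for j
    using that by (auto simp: F_def I_def fin_quot_idx_finite)
  then have "compact_space T"
    unfolding T_def compact_space_product_topology by (simp add: compact_space_discrete_topology)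
  moreover have "closedin T C" if C: "C \<in> \<C>" for C
  proof -
    obtain \<K> where \<K>: "C = E \<K>" "finite \<K>" "\<K> \<subseteq> fin_quot_idx G"
      using C unfolding \<C>_def by blast
    have "{..<n} \<times> \<K> \<subseteq> I"
      using \<K> by (auto simp: I_def)
    then show ?thesis
      unfolding \<K>(1) E_def T_def using \<K>(2) finF by (intro closedin_finite_coords) auto
  qed
  moreover have "\<Inter> \<F> \<noteq> {}" if \<F>: "finite \<F>" "\<F> \<subseteq> \<C>" for \<F>
  proof -
    obtain \<L> where \<L>: "finite \<L>" "\<L> \<subseteq> {\<K>. finite \<K> \<and> \<K> \<subseteq> fin_quot_idx G}" "\<F> = E ` \<L>"
      using finite_subset_image[OF \<F>[unfolded \<C>_def]] by blast
    \<comment> \<open>A solution modulo an \<open>N\<close> below all levels that occur in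
      \<open>\<L>\<close> solves the equation at each of them.\<close>
    obtain N where N: "N \<in> fin_quot_idx G" "\<And>M. M \<in> \<Union> \<L> \<Longrightarrow> N \<subseteq> M"
      using fin_quot_idx_lower_bound[of "\<Union> \<L>"] \<L> by blast
    obtain u where u: "\<And>i. i < n \<Longrightarrow> u i \<in> carrier G" "N #> word_eval G w u = N #> g"
      using res N(1) unfolding residual_value_def by blast
    define x where "x = (\<lambda>(i, M)\<in>I. M #> u i)"
    have "x \<in> Pi\<^sub>E I F"
      using u(1) by (auto simp: x_def I_def F_def carrier_Mod PiE_iff)
    moreover have "good \<K> x u" if \<K>: "\<K> \<in> \<L>" for \<K>
    proof -
      have wu: "word_eval G w u \<in> carrier G"
        using u(1) w by (intro word_eval_closed is_group) simp
      have "M #> word_eval G w u = M #> g" "\<forall>i<n. x (i, M) = M #> u i" if M: "M \<in> \<K>" for M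
      proof -
        have "M \<in> fin_quot_idx G" "N \<subseteq> M"
          using \<L>(2) N(2) \<K> M by blast+
        then show "M #> word_eval G w u = M #> g" "\<forall>i<n. x (i, M) = M #> u i"
          using rcos_eq_mono[OF u(2)] wu g N(1) by (auto simp: fin_quot_idx_subgroup x_def I_def)
      qed
      then show ?thesis
        using u(1) by (auto simp: good_def)
    qed
    ultimately have "x \<in> \<Inter> \<F>"
      unfolding \<L>(3) by (auto simp: E_iff)
    then show ?thesis by blast
  qed
  ultimately have "\<Inter> \<C> \<noteq> {}"
    unfolding compact_space_fip by blast
  then obtain x where x: "x \<in> E \<K>" if "finite \<K>" "\<K> \<subseteq> fin_quot_idx G" for \<K>
    by (auto simp: \<C>_def)
  define a where "a i = (\<lambda>N\<in>fin_quot_idx G. x (i, N))" for i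
  have a_mem: "a i \<in> carrier (profinite G)" if i: "i < n" for i
  proof (rule profiniteI_rep)
    fix N M assume NM: "N \<in> fin_quot_idx G" "M \<in> fin_quot_idx G" "N \<subseteq> M"
    then obtain u where "good {N, M} x u"
      using x[of "{N, M}"] by (auto simp: E_iff)
    then show "\<exists>u\<in>carrier G. a i N = N #> u \<and> a i M = M #> u"
      using NM i by (intro bexI[of _ "u i"]) (auto simp: good_def a_def)
  qed (simp add: a_def)
  moreover have "word_eval (profinite G) w a = diag_map G g"
  proof (rule profinite_eqI)
    show "word_eval (profinite G) w a \<in> carrier (profinite G)"
      using a_mem w by (intro word_eval_closed group_profinite) simp
    show "diag_map G g \<in> carrier (profinite G)"
      using g by (rule diag_map_in_profinite)
    fix N assume N: "N \<in> fin_quot_idx G"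
    then obtain u where u: "good {N} x u"
      using x[of "{N}"] by (auto simp: E_iff)
    have "word_eval (profinite G) w a N = word_eval (G Mod N) w (\<lambda>i. a i N)"
      using N a_mem w by (simp add: profinite_word_eval)
    also have "\<dots> = word_eval (G Mod N) w (\<lambda>i. N #> u i)"
      using u N w by (intro word_eval_cong) (simp add: good_def a_def)
    also have "\<dots> = N #> word_eval G w u"
      using u N w by (subst rcos_word_eval) (auto simp: good_def)
    finally show "word_eval (profinite G) w a N = diag_map G g N"
      using u N by (simp add: good_def diag_map_def)
  qed
  ultimately show ?thesis
    using that by blast
qed

end

text \<open>Compactness identifies profinite values with residual values, and values in the free
  group are residual, so only one implication remains.\<close>

lemma local_to_global_iff:
  assumes "w \<in> carrier (free_grp n)" and free_group: "group (free_grp k)"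
  shows "local_to_global n w k \<longleftrightarrow> (\<forall>g\<in>carrier (free_grp k). residual_value (free_grp k) n w g \<longrightarrow>
    (\<exists>a. (\<forall>i<n. a i \<in> carrier (free_grp k)) \<and> word_eval (free_grp k) w a = g))"
proof -
  interpret group "free_grp k" by fact
  have w: "i < n" if "i \<in> fst ` set w" for i
    using fst_set_free_grp[OF assms(1) that] .
  have "(\<exists>a. (\<forall>i<n. a i \<in> carrier (profinite (free_grp k))) \<and>
             word_eval (profinite (free_grp k)) w a = diag_map (free_grp k) g)
     \<longleftrightarrow> residual_value (free_grp k) n w g" if "g \<in> carrier (free_grp k)" for g
    using residual_value_if_profinite_value[OF w] profinite_value_if_residual_value[OF w that]
    by metis
  moreover have "residual_value (free_grp k) n w g"
    if "\<exists>a. (\<forall>i<n. a i \<in> carrier (free_grp k)) \<and> word_eval (free_grp k) w a = g" for g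
    using that by (auto simp: residual_value_def)
  ultimately show ?thesis
    unfolding local_to_global_def by blast
qed

section \<open>Rewriting along a double cover\<close>

text \<open>The homomorphism to the group of order two that is non-trivial exactly on the generators
  in \<open>S\<close>; a letter and its inverse count alike.\<close>

definition parity :: "nat set \<Rightarrow> letter list \<Rightarrow> bool" where
  "parity S u \<longleftrightarrow> odd (length (filter (\<lambda>l. fst l \<in> S) u))"

lemma parity_simps [simp]:
  "\<not> parity S []"
  "parity S (l # u) \<longleftrightarrow> (fst l \<in> S) \<noteq> parity S u"
  "parity S (u @ v) \<longleftrightarrow> parity S u \<noteq> parity S v"
  "\<not> parity {} u"
  by (auto simp: parity_def)

lemma parity_red [simp]: "parity S (red u) \<longleftrightarrow> parity S u"
proof (induction u)
  case (Cons a u)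
  then show ?case
    by (cases rule: push_cases[where a = a and ys = "red u"]) auto
qed simp

text \<open>The symmetric difference is the sum of two parity homomorphisms; two distinct ones that
  agree on some words thus yield a non-zero one vanishing there.\<close>

lemma parity_sym_diff:
  "parity (S - T \<union> (T - S)) u \<longleftrightarrow> parity S u \<noteq> parity T u"
  by (induction u) auto

text \<open>
  There are \<open>2 ^ m\<close> parity homomorphisms to the field with two elements, so two of them agree on
  \<open>n < m\<close> given words.
\<close>

lemma parity_vanishing:
  fixes a :: "nat \<Rightarrow> letter list"
  assumes "n < m"
  obtains S where "S \<subseteq> {..<m}" "S \<noteq> {}" "\<And>i. i < n \<Longrightarrow> \<not> parity S (a i)"
proof -
  define f where "f S = {i. i < n \<and> parity S (a i)}" for S
  have "card (f ` Pow {..<m}) \<le> card (Pow {..<n})"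
    by (rule card_mono) (auto simp: f_def)
  also have "\<dots> < card (Pow {..<m})"
    using assms by (simp add: card_Pow)
  finally have "\<not> inj_on f (Pow {..<m})"
    by (rule pigeonhole)
  then obtain S T where "S \<subseteq> {..<m}" "T \<subseteq> {..<m}" "S \<noteq> T" "f S = f T"
    unfolding inj_on_def by blast
  moreover from \<open>f S = f T\<close> have "parity S (a i) = parity T (a i)" if "i < n" for i
    using that by (auto simp: f_def)
  ultimately show ?thesis
    by (intro that[of "S - T \<union> (T - S)"]) (auto simp: parity_sym_diff)
qed

text \<open>
  Reidemeister--Schreier rewriting for the double cover of the rose in which the letters of \<open>S\<close>
  exchange the two sheets: \<open>e v x\<close> is the label of the edge \<open>x\<close> leaving sheet \<open>v\<close>, and
  \<open>schreier H S e v u\<close> is the product of the labels along the lift of \<open>u\<close> starting in sheet \<open>v\<close>.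
  On words it is a cocycle; on loops, i.e. on words of even parity, a homomorphism.
\<close>

fun schreier ::
    "('g, 'm) monoid_scheme \<Rightarrow> nat set \<Rightarrow> (bool \<Rightarrow> nat \<Rightarrow> 'g) \<Rightarrow> bool \<Rightarrow> letter list \<Rightarrow> 'g" where
  "schreier H S e v [] = \<one>\<^bsub>H\<^esub>"
| "schreier H S e v ((x, b) # u) =
    (if b then inv\<^bsub>H\<^esub> (e (v \<noteq> (x \<in> S)) x) else e v x) \<otimes>\<^bsub>H\<^esub> schreier H S e (v \<noteq> (x \<in> S)) u"

text \<open>When no letter changes sheet, rewriting is plain evaluation, which thereby inherits the
  product rule and the invariance under reduction.\<close>

lemma word_eval_eq_schreier: "word_eval G u c = schreier G {} (\<lambda>_. c) v u"
  by (induction u) auto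

locale labelling = group H for H (structure) +
  fixes S :: "nat set" and e :: "bool \<Rightarrow> nat \<Rightarrow> 'a"
  assumes label_closed [simp]: "e v x \<in> carrier H"
begin

lemma schreier_closed [simp]: "schreier H S e v u \<in> carrier H"
  by (induction u arbitrary: v) auto

lemma schreier_append:
  "schreier H S e v (u @ u') = schreier H S e v u \<otimes> schreier H S e (v \<noteq> parity S u) u'"
proof (induction u arbitrary: v)
  case (Cons l u)
  have "(v \<noteq> (fst l \<in> S)) \<noteq> parity S u \<longleftrightarrow> v \<noteq> parity S (l # u)"
    by auto
  then show ?case
    using Cons by (cases l) (simp add: m_assoc)
qed simp

text \<open>A letter followed by its inverse runs along one edge and back, so the labels cancel and
  the sheet is restored.\<close>

lemma schreier_cancel: "schreier H S e v (a # flip a # u) = schreier H S e v u"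
proof -
  have "((v \<noteq> P) \<noteq> P) = v" for P
    by auto
  then show ?thesis
    by (cases a) (simp add: m_assoc[symmetric])
qed

lemma schreier_red [simp]: "schreier H S e v (red u) = schreier H S e v u"
proof (induction u arbitrary: v)
  case (Cons a u)
  have "schreier H S e v (red (a # u)) = schreier H S e v (a # red u)"
  proof (cases rule: push_cases[where a = a and ys = "red u"])
    case (cancel zs)
    then show ?thesis
      using schreier_cancel by simp
  qed simp
  also have "\<dots> = schreier H S e v (a # u)"
    using Cons by (cases a) simp
  finally show ?case .
qed simp

text \<open>The lift of the inverse starts in the sheet where the lift of \<open>u\<close> ends and
  retraces it; this is the cocycle rule applied to \<open>u\<close> times its inverse.\<close>

lemma schreier_inv:
  assumes "u \<in> carrier (free_grp m)"
  shows "schreier H S e (v \<noteq> parity S u) (inv\<^bsub>free_grp m\<^esub> u) = inv (schreier H S e v u)"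
proof -
  interpret F: group "free_grp m"
    by (rule group_free_grp)
  have "schreier H S e v (red (u @ inv\<^bsub>free_grp m\<^esub> u)) = \<one>"
    using F.r_inv[OF assms] by simp
  then have "schreier H S e v u \<otimes> schreier H S e (v \<noteq> parity S u) (inv\<^bsub>free_grp m\<^esub> u) = \<one>"
    by (simp add: schreier_append)
  then show ?thesis
    using inv_equality[OF r_inv] by (metis inv_equality inv_inv schreier_closed)
qed

end

lemma parity_inv_free_grp:
  assumes "u \<in> carrier (free_grp m)"
  shows "parity S (inv\<^bsub>free_grp m\<^esub> u) \<longleftrightarrow> parity S u"
proof -
  have "red (u @ inv\<^bsub>free_grp m\<^esub> u) = []"
    using group.r_inv[OF group_free_grp assms] by simp
  then have "\<not> parity S (u @ inv\<^bsub>free_grp m\<^esub> u)"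
    by (metis parity_red parity_simps(1))
  then show ?thesis
    by simp
qed

lemma subgroup_even: "subgroup {u \<in> carrier (free_grp m). \<not> parity S u} (free_grp m)"
proof -
  interpret F: group "free_grp m"
    by (rule group_free_grp)
  show ?thesis
    using F.m_closed F.one_closed by (intro F.subgroupI) (auto simp: parity_inv_free_grp)
qed

lemma word_eval_hom_free_grp:
  assumes "group G" "\<And>i. c i \<in> carrier G"
  shows "(\<lambda>u. word_eval G u c) \<in> hom (free_grp p) G"
proof -
  interpret group G by fact
  interpret labelling G "{}" "\<lambda>_. c"
    by unfold_locales (rule assms)
  show ?thesis
    by (auto simp: hom_def word_eval_eq_schreier[where v = False] schreier_append)
qed

lemma word_eval_letters:
  "set u \<subseteq> {0..<m} \<times> UNIV \<Longrightarrow> word_eval (free_grp m) u (\<lambda>x. [(x, False)]) = red u"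
  by (induction u) (auto simp: inv_free_grp_letter)

context labelling
begin

lemma schreier_hom:
  "schreier H S e False \<in> hom (free_grp m\<lparr>carrier := {u \<in> carrier (free_grp m). \<not> parity S u}\<rparr>) H"
  by (auto simp: hom_def schreier_append)

lemma schreier_word_eval:
  assumes "\<And>i. i \<in> fst ` set w \<Longrightarrow> a i \<in> carrier (free_grp m) \<and> \<not> parity S (a i)"
  shows "schreier H S e False (word_eval (free_grp m) w a) =
    word_eval H w (\<lambda>i. schreier H S e False (a i))"
  using assms
  by (intro hom_on_subgroup_word_eval[OF group_free_grp is_group subgroup_even schreier_hom]) simp

text \<open>
  Requiring \<open>schreier H S e v u \<in> M\<close> from both sheets, not only from the base, makes the
  preimage normal in the whole free group.
\<close>

lemma schreier_preimage_fin_quot_idx: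
  assumes M: "M \<in> fin_quot_idx H"
  shows "{u \<in> carrier (free_grp m). \<not> parity S u \<and> (\<forall>v. schreier H S e v u \<in> M)}
    \<in> fin_quot_idx (free_grp m)" (is "?N \<in> _")
proof -
  interpret F: group "free_grp m"
    by (rule group_free_grp)
  interpret M: normal M H
    using M by (rule fin_quot_idx_normal)
  note Msub = fin_quot_idx_subgroup[OF M]
  have red_closed: "red (x @ y) \<in> carrier (free_grp m)"
    if "x \<in> carrier (free_grp m)" "y \<in> carrier (free_grp m)" for x y
    using F.m_closed[OF that] by simp
  have "subgroup ?N (free_grp m)"
  proof (rule F.subgroupI)
    show "?N \<noteq> {}"
      using F.one_closed by (auto intro!: exI[of _ "[]"])
  next
    fix u assume u: "u \<in> ?N"
    have "schreier H S e v (inv\<^bsub>free_grp m\<^esub> u) = inv (schreier H S e v u)" for v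
      using schreier_inv[of u m v] u by simp
    then show "inv\<^bsub>free_grp m\<^esub> u \<in> ?N"
      using u by (auto simp: parity_inv_free_grp)
  qed (auto simp: red_closed schreier_append)
  moreover have "x \<otimes>\<^bsub>free_grp m\<^esub> h \<otimes>\<^bsub>free_grp m\<^esub> inv\<^bsub>free_grp m\<^esub> x \<in> ?N"
    if x: "x \<in> carrier (free_grp m)" and h: "h \<in> ?N" for x h
  proof -
    let ?k = "red (red (x @ h) @ inv\<^bsub>free_grp m\<^esub> x)"
    have "schreier H S e v ?k \<in> M" for v
    proof -
      \<comment> \<open>Conjugation by \<open>x\<close> moves the lift of \<open>h\<close> to the
        sheet reached by \<open>x\<close>, whence the condition on both sheets.\<close>
      have "schreier H S e v ?k =
          schreier H S e v x \<otimes> schreier H S e (v \<noteq> parity S x) h \<otimes> inv (schreier H S e v x)"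
        using h schreier_inv[OF x, of v] by (simp add: schreier_append m_assoc)
      also have "\<dots> \<in> M"
        using h by (intro M.inv_op_closed2) simp_all
      finally show ?thesis .
    qed
    moreover have "\<not> parity S ?k"
      using x h by (simp add: parity_inv_free_grp)
    moreover have "?k \<in> carrier (free_grp m)"
      using x h by (intro red_closed) simp_all
    ultimately show ?thesis
      unfolding mult_free_grp by blast
  qed
  ultimately have normal: "?N \<lhd> free_grp m"
    unfolding F.normal_inv_iff by blast
  show ?thesis
  proof (rule F.fin_quot_idxI[OF normal])
    \<comment> \<open>Parity and the cosets of the rewritings from the two sheets determine the
      coset of \<open>?N\<close>.\<close>
    let ?f = "\<lambda>u. (parity S u, M #> schreier H S e False u, M #> schreier H S e True u)"
    have "?f ` carrier (free_grp m) \<subseteq> UNIV \<times> carrier (H Mod M) \<times> carrier (H Mod M)"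
      by (auto simp: carrier_Mod)
    then show "finite (?f ` carrier (free_grp m))"
      by (rule finite_subset) (intro finite_SigmaI fin_quot_idx_finite[OF M] finite)
    fix x y assume x: "x \<in> carrier (free_grp m)" and y: "y \<in> carrier (free_grp m)"
      and "?f x = ?f y"
    then have par: "parity S x = parity S y"
      and eq: "M #> schreier H S e v x = M #> schreier H S e v y" for v
      by (cases v; simp)+
    have "schreier H S e v (red (x @ inv\<^bsub>free_grp m\<^esub> y)) =
        schreier H S e v x \<otimes> inv (schreier H S e v y)" for v
      using schreier_inv[OF y, of v] par by (simp add: schreier_append)
    then show "x \<otimes>\<^bsub>free_grp m\<^esub> inv\<^bsub>free_grp m\<^esub> y \<in> ?N"
      using x y par eq by (auto simp: red_closed parity_inv_free_grp rcos_eq_iff[OF Msub, symmetric])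
  qed
qed

text \<open>Even witnesses modulo the preimage \<open>?N\<close> of \<open>M\<close> rewrite to
  witnesses modulo \<open>M\<close>. As \<open>?N\<close> consists of even words, \<open>g\<close>
  is congruent to an even word and so is even itself.\<close>

lemma residual_value_schreier:
  assumes w: "\<And>i. i \<in> fst ` set w \<Longrightarrow> i < n" and g: "g \<in> carrier (free_grp m)"
    and res: "\<And>N. N \<in> fin_quot_idx (free_grp m) \<Longrightarrow>
      \<exists>a. (\<forall>i<n. a i \<in> carrier (free_grp m) \<and> \<not> parity S (a i)) \<and>
        N #>\<^bsub>free_grp m\<^esub> word_eval (free_grp m) w a = N #>\<^bsub>free_grp m\<^esub> g"
  shows "\<not> parity S g" and "residual_value H n w (schreier H S e False g)"
proof -
  interpret F: group "free_grp m"
    by (rule group_free_grp)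
  have *: "\<exists>a. (\<forall>i<n. a i \<in> carrier H) \<and>
      M #> word_eval H w a = M #> schreier H S e False g \<and> \<not> parity S g"
    if M: "M \<in> fin_quot_idx H" for M
  proof -
    let ?N = "{u \<in> carrier (free_grp m). \<not> parity S u \<and> (\<forall>v. schreier H S e v u \<in> M)}"
    have N: "?N \<in> fin_quot_idx (free_grp m)"
      by (rule schreier_preimage_fin_quot_idx[OF M])
    obtain a where a: "\<And>i. i < n \<Longrightarrow> a i \<in> carrier (free_grp m) \<and> \<not> parity S (a i)"
      and eq: "?N #>\<^bsub>free_grp m\<^esub> word_eval (free_grp m) w a = ?N #>\<^bsub>free_grp m\<^esub> g"
      using res[OF N] by blast
    let ?u = "word_eval (free_grp m) w a"
    have u: "?u \<in> {u \<in> carrier (free_grp m). \<not> parity S u}"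
      using a w by (intro word_eval_in_subgroup group_free_grp subgroup_even) simp
    then have "?u \<otimes>\<^bsub>free_grp m\<^esub> inv\<^bsub>free_grp m\<^esub> g \<in> ?N"
      using eq g F.rcos_eq_iff[OF fin_quot_idx_subgroup[OF N], of ?u g] by blast
    then have mem: "schreier H S e False (?u @ inv\<^bsub>free_grp m\<^esub> g) \<in> M"
      and par: "\<not> parity S (?u @ inv\<^bsub>free_grp m\<^esub> g)"
      by auto
    then have g_even: "\<not> parity S g"
      using u g by (simp add: parity_inv_free_grp)
    then have "schreier H S e False ?u \<otimes> inv (schreier H S e False g) \<in> M"
      using mem u schreier_inv[OF g, of False] by (simp add: schreier_append)
    then have "M #> schreier H S e False ?u = M #> schreier H S e False g"
      by (simp add: rcos_eq_iff fin_quot_idx_subgroup[OF M])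
    moreover have "schreier H S e False ?u = word_eval H w (\<lambda>i. schreier H S e False (a i))"
      using a w by (intro schreier_word_eval) simp
    ultimately show ?thesis
      using g_even by (intro exI[of _ "\<lambda>i. schreier H S e False (a i)"]) simp
  qed
  \<comment> \<open>Any single level reveals the parity of \<open>g\<close>; the whole of
    \<open>H\<close> is one.\<close>
  show "\<not> parity S g"
    using *[OF carrier_in_fin_quot_idx] by blast
  show "residual_value H n w (schreier H S e False g)"
    unfolding residual_value_def using * by blast
qed

end

text \<open>
  If \<open>t v\<close> represents the path from the base sheet to sheet \<open>v\<close> and \<open>c\<close> evaluates each label to
  the corresponding Schreier generator, then \<open>c\<close> inverts the rewriting of loops.
\<close>

lemma word_eval_schreier:
  assumes G: "group G" and c: "\<And>i. c i \<in> carrier G" and t: "\<And>v. t v \<in> carrier G"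
    and e: "\<And>v x. e v x \<in> carrier (free_grp p)"
    and y: "\<And>x. x \<in> fst ` set u \<Longrightarrow> y x \<in> carrier G"
    and edge: "\<And>v x. x \<in> fst ` set u \<Longrightarrow>
      word_eval G (e v x) c \<otimes>\<^bsub>G\<^esub> t (v \<noteq> (x \<in> S)) = t v \<otimes>\<^bsub>G\<^esub> y x"
  shows "word_eval G (schreier (free_grp p) S e v u) c \<otimes>\<^bsub>G\<^esub> t (v \<noteq> parity S u) =
    t v \<otimes>\<^bsub>G\<^esub> word_eval G u y"
  using y edge
proof (induction u arbitrary: v)
  case Nil
  show ?case
    using t G by (simp add: group.is_monoid)
next
  case (Cons l u)
  interpret G: group G by fact
  interpret F: labelling "free_grp p" S e
    using e group_free_grp by (simp add: labelling_def labelling_axioms_def)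
  interpret \<psi>: group_hom "free_grp p" G "\<lambda>u. word_eval G u c"
    using word_eval_hom_free_grp[OF G c]
    by (simp add: group_hom_def group_hom_axioms_def group_free_grp)
  obtain x b where l: "l = (x, b)"
    by (cases l)
  let ?v = "v \<noteq> (x \<in> S)"
  let ?R = "word_eval G (schreier (free_grp p) S e ?v u) c"
  let ?W = "word_eval G u y"
  have yx: "y x \<in> carrier G"
    using Cons.prems l by simp
  have W: "?W \<in> carrier G"
    using Cons.prems by (intro word_eval_closed G) simp
  have R: "?R \<in> carrier G"
    using \<psi>.hom_closed F.schreier_closed by blast
  have t_eq: "(v \<noteq> parity S (l # u)) = (?v \<noteq> parity S u)"
    by (auto simp: l)
  have IH: "?R \<otimes>\<^bsub>G\<^esub> t (?v \<noteq> parity S u) = t ?v \<otimes>\<^bsub>G\<^esub> ?W"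
    using Cons.IH[of ?v] Cons.prems by simp
  define d where "d = (if b then inv\<^bsub>free_grp p\<^esub> (e ?v x) else e v x)"
  have d: "d \<in> carrier (free_grp p)"
    by (simp add: d_def)
  have "word_eval G d c \<otimes>\<^bsub>G\<^esub> t ?v = t v \<otimes>\<^bsub>G\<^esub> (if b then inv\<^bsub>G\<^esub> (y x) else y x)"
  proof (cases b)
    case True
    \<comment> \<open>An inverse letter runs backwards along the edge \<open>x\<close> that leaves
      sheet \<open>?v\<close>, so the edge identity is taken at \<open>?v\<close> and
      inverted.\<close>
    have "(?v \<noteq> (x \<in> S)) = v"
      by auto
    then have edge': "word_eval G (e ?v x) c \<otimes>\<^bsub>G\<^esub> t v = t ?v \<otimes>\<^bsub>G\<^esub> y x"
      using Cons.prems(2)[of x ?v] l by simp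
    let ?A = "word_eval G (e ?v x) c"
    have A: "?A \<in> carrier G"
      using \<psi>.hom_closed[of "e ?v x"] by simp
    have "t ?v = t ?v \<otimes>\<^bsub>G\<^esub> y x \<otimes>\<^bsub>G\<^esub> inv\<^bsub>G\<^esub> (y x)"
      using t yx by (simp add: G.m_assoc)
    then have "inv\<^bsub>G\<^esub> ?A \<otimes>\<^bsub>G\<^esub> t ?v = inv\<^bsub>G\<^esub> ?A \<otimes>\<^bsub>G\<^esub> (?A \<otimes>\<^bsub>G\<^esub> t v \<otimes>\<^bsub>G\<^esub> inv\<^bsub>G\<^esub> (y x))"
      unfolding edge' by (rule arg_cong)
    also have "\<dots> = t v \<otimes>\<^bsub>G\<^esub> inv\<^bsub>G\<^esub> (y x)"
      using A t yx by (simp add: G.m_assoc[symmetric])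
    also have "inv\<^bsub>G\<^esub> ?A = word_eval G d c"
      using True \<psi>.hom_inv[of "e ?v x"] by (simp add: d_def)
    finally show ?thesis
      using True by simp
  qed (use Cons.prems(2)[of x v] l in \<open>simp add: d_def\<close>)
  note d_edge = this
  have "word_eval G (schreier (free_grp p) S e v (l # u)) c = word_eval G d c \<otimes>\<^bsub>G\<^esub> ?R"
    using \<psi>.hom_mult[OF d, of "schreier (free_grp p) S e ?v u"] unfolding l d_def by simp
  then have "word_eval G (schreier (free_grp p) S e v (l # u)) c \<otimes>\<^bsub>G\<^esub> t (v \<noteq> parity S (l # u)) =
      word_eval G d c \<otimes>\<^bsub>G\<^esub> t ?v \<otimes>\<^bsub>G\<^esub> ?W"
    unfolding t_eq using \<psi>.hom_closed[OF d] R t W IH by (simp add: G.m_assoc)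
  also have "\<dots> = t v \<otimes>\<^bsub>G\<^esub> word_eval G (l # u) y"
    unfolding d_edge using t yx W l by (simp add: G.m_assoc)
  finally show ?case .
qed

section \<open>Length of rewritten words\<close>

lemma length_inv_edge:
  "d = [] \<or> (\<exists>j<p. d = [(j, False)]) \<Longrightarrow> length (inv\<^bsub>free_grp p\<^esub> d) \<le> length d"
  using monoid.inv_one[OF group.is_monoid[OF group_free_grp[of p]]] by (auto simp: inv_free_grp_letter)

lemma length_schreier:
  assumes e: "\<And>v x. e v x = [] \<or> (\<exists>j<p. e v x = [(j, False)])"
  shows "length (schreier (free_grp p) S e v u) \<le> length u"
proof (induction u arbitrary: v)
  case (Cons l u)
  obtain x b where l: "l = (x, b)"
    by (cases l)
  let ?v = "v \<noteq> (x \<in> S)"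
  let ?d = "if b then inv\<^bsub>free_grp p\<^esub> (e ?v x) else e v x"
  have "length ?d \<le> 1"
    using length_inv_edge[OF e, of ?v x] e[of ?v x] e[of v x] by auto
  moreover have "length (schreier (free_grp p) S e v (l # u)) \<le>
      length ?d + length (schreier (free_grp p) S e ?v u)"
    using length_red by (simp add: l) (metis length_append)+
  ultimately show ?case
    using Cons[of ?v] by simp
qed simp

text \<open>As \<open>u\<close> is even, the letter \<open>(x, b)\<close> starts in sheet
  \<open>False\<close>. If \<open>b\<close> is false it follows the edge leaving
  \<open>False\<close>, otherwise it runs backwards along the edge leaving \<open>True\<close>;
  either way it meets the empty label \<open>e b x\<close> and contributes nothing.\<close>

lemma length_schreier_less:
  assumes e: "\<And>v x. e v x = [] \<or> (\<exists>j<p. e v x = [(j, False)])"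
    and tree: "e b x = []" and x: "x \<in> S" and u: "\<not> parity S u"
  shows "length (schreier (free_grp p) S e False (u @ (x, b) # u')) < length (u @ (x, b) # u')"
proof -
  have "e v x \<in> carrier (free_grp p)" for v x
    using e[of v x] by (auto simp: carrier_free_grp reduced_Cons)
  then interpret labelling "free_grp p" S e
    using group_free_grp by (simp add: labelling_def labelling_axioms_def)
  have "schreier (free_grp p) S e False ((x, b) # u') = schreier (free_grp p) S e True u'"
    using tree x monoid.inv_one[OF group.is_monoid[OF group_free_grp[of p]]] schreier_closed[of True u']
    by (auto simp: carrier_free_grp)
  then have "schreier (free_grp p) S e False (u @ (x, b) # u') =
      red (schreier (free_grp p) S e False u @ schreier (free_grp p) S e True u')"
    using u by (simp add: schreier_append)
  also have "length \<dots> \<le> length (schreier (free_grp p) S e False u) + length (schreier (free_grp p) S e True u')"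
    by (metis length_append length_red)
  also have "\<dots> \<le> length u + length u'"
    by (intro add_mono length_schreier[OF e])
  finally show ?thesis
    by simp
qed

section \<open>Descent on the length of the target\<close>

text \<open>If each non-empty \<open>S\<close> failed at some level \<open>M S\<close>, an
  \<open>N\<close> below these finitely many levels would have a witness; some \<open>S\<close>
  vanishes on it, and it contradicts the failure at \<open>M S\<close>.\<close>

lemma residual_value_even:
  assumes res: "residual_value (free_grp m) n w g" and "n < m"
    and w: "\<And>i. i \<in> fst ` set w \<Longrightarrow> i < n" and g: "g \<in> carrier (free_grp m)"
  obtains S where "S \<subseteq> {..<m}" "S \<noteq> {}"
    "\<And>N. N \<in> fin_quot_idx (free_grp m) \<Longrightarrow>
      \<exists>a. (\<forall>i<n. a i \<in> carrier (free_grp m) \<and> \<not> parity S (a i)) \<and>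
        N #>\<^bsub>free_grp m\<^esub> word_eval (free_grp m) w a = N #>\<^bsub>free_grp m\<^esub> g"
proof -
  interpret F: group "free_grp m"
    by (rule group_free_grp)
  define P where "P S N \<longleftrightarrow> (\<exists>a. (\<forall>i<n. a i \<in> carrier (free_grp m) \<and> \<not> parity S (a i)) \<and>
        N #>\<^bsub>free_grp m\<^esub> word_eval (free_grp m) w a = N #>\<^bsub>free_grp m\<^esub> g)" for S N
  have "\<exists>S\<in>Pow {..<m} - {{}}. \<forall>N\<in>fin_quot_idx (free_grp m). P S N"
  proof (rule ccontr)
    assume "\<not> ?thesis"
    then obtain M where M: "M S \<in> fin_quot_idx (free_grp m)" "\<not> P S (M S)"
      if "S \<in> Pow {..<m} - {{}}" for S
      by metis
    have fin: "finite (M ` (Pow {..<m} - {{}}))" "M ` (Pow {..<m} - {{}}) \<subseteq> fin_quot_idx (free_grp m)"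
      using M by auto
    obtain N where N: "N \<in> fin_quot_idx (free_grp m)"
        "\<And>K. K \<in> M ` (Pow {..<m} - {{}}) \<Longrightarrow> N \<subseteq> K"
      using F.fin_quot_idx_lower_bound[OF fin] by blast
    obtain a where a: "\<And>i. i < n \<Longrightarrow> a i \<in> carrier (free_grp m)"
      and eq: "N #>\<^bsub>free_grp m\<^esub> word_eval (free_grp m) w a = N #>\<^bsub>free_grp m\<^esub> g"
      using res N(1) unfolding residual_value_def by blast
    obtain S where S: "S \<subseteq> {..<m}" "S \<noteq> {}" "\<And>i. i < n \<Longrightarrow> \<not> parity S (a i)"
      using parity_vanishing[OF \<open>n < m\<close>] by blast
    have "word_eval (free_grp m) w a \<in> carrier (free_grp m)"
      using a w by (intro word_eval_closed group_free_grp) simp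
    moreover have "N \<subseteq> M S" "M S \<in> fin_quot_idx (free_grp m)"
      using N(2) M S by blast+
    ultimately have "M S #>\<^bsub>free_grp m\<^esub> word_eval (free_grp m) w a = M S #>\<^bsub>free_grp m\<^esub> g"
      using F.rcos_eq_mono[OF eq] g N(1) fin_quot_idx_subgroup by blast
    then have "P S (M S)"
      unfolding P_def using a S(3) by blast
    then show False
      using M S by blast
  qed
  then show ?thesis
    using that unfolding P_def by blast
qed

text \<open>One descent step, used both for killing a letter (\<open>S = {}\<close>) and for a
  double cover. The homomorphism sending generator \<open>j\<close> to \<open>c j\<close> takes the
  rewriting of \<open>g\<close> back to \<open>g\<close>, so it carries solutions for the rewritten
  target to solutions for \<open>g\<close>.\<close>

lemma value_descent:
  assumes w: "\<And>i. i \<in> fst ` set w \<Longrightarrow> i < n" and g: "g \<in> carrier (free_grp m)"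
    and res: "\<And>N. N \<in> fin_quot_idx (free_grp m) \<Longrightarrow>
      \<exists>a. (\<forall>i<n. a i \<in> carrier (free_grp m) \<and> \<not> parity S (a i)) \<and>
        N #>\<^bsub>free_grp m\<^esub> word_eval (free_grp m) w a = N #>\<^bsub>free_grp m\<^esub> g"
    and e: "\<And>v x. e v x \<in> carrier (free_grp p)"
    and c: "\<And>i. c i \<in> carrier (free_grp m)"
    and t: "t False = []" "t True \<in> carrier (free_grp m)"
    and edge: "\<And>v x. x \<in> fst ` set g \<Longrightarrow>
      red (word_eval (free_grp m) (e v x) c @ t (v \<noteq> (x \<in> S))) = red (t v @ [(x, False)])"
    and IH: "residual_value (free_grp p) n w (schreier (free_grp p) S e False g) \<Longrightarrow>
      \<exists>b. (\<forall>i<n. b i \<in> carrier (free_grp p)) \<and>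
        word_eval (free_grp p) w b = schreier (free_grp p) S e False g"
  shows "\<exists>a. (\<forall>i<n. a i \<in> carrier (free_grp m)) \<and> word_eval (free_grp m) w a = g"
proof -
  interpret labelling "free_grp p" S e
    using e group_free_grp by (simp add: labelling_def labelling_axioms_def)
  interpret \<psi>: group_hom "free_grp p" "free_grp m" "\<lambda>u. word_eval (free_grp m) u c"
    using word_eval_hom_free_grp[OF group_free_grp c]
    by (simp add: group_hom_def group_hom_axioms_def group_free_grp)
  have even: "\<not> parity S g"
    and "residual_value (free_grp p) n w (schreier (free_grp p) S e False g)"
    using residual_value_schreier[OF w g res] by blast+
  then obtain b where b: "\<And>i. i < n \<Longrightarrow> b i \<in> carrier (free_grp p)"
    "word_eval (free_grp p) w b = schreier (free_grp p) S e False g"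
    using IH by blast
  let ?\<psi> = "\<lambda>u. word_eval (free_grp m) u c"
  have t': "t v \<in> carrier (free_grp m)" for v
    using t by (cases v) (auto simp: carrier_free_grp)
  have letters: "[(x, False)] \<in> carrier (free_grp m)" if "x \<in> fst ` set g" for x
    using g that by (auto simp: carrier_free_grp reduced_Cons)
  have "word_eval (free_grp m) w (\<lambda>i. ?\<psi> (b i)) = ?\<psi> (word_eval (free_grp p) w b)"
    using b w by (intro hom_word_eval[OF group_free_grp group_free_grp \<psi>.homh, symmetric]) simp
  also have "\<dots> = ?\<psi> (schreier (free_grp p) S e False g)"
    by (simp add: b)
  also have "red \<dots> = red g"
  proof -
    \<comment> \<open>The lift of the even word \<open>g\<close> begins and ends in the base sheet,
      where \<open>t\<close> is empty. The \<open>red\<close> on both sides comes from the group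
      product and is removed below, as both words are reduced.\<close>
    have "?\<psi> (schreier (free_grp p) S e False g) \<otimes>\<^bsub>free_grp m\<^esub> t (False \<noteq> parity S g) =
        t False \<otimes>\<^bsub>free_grp m\<^esub> word_eval (free_grp m) g (\<lambda>x. [(x, False)])"
      by (rule word_eval_schreier[OF group_free_grp c t' e letters]) (simp_all add: edge[simplified])
    then show ?thesis
      using even t(1) g by (simp add: word_eval_letters carrier_free_grp)
  qed
  finally have "red (word_eval (free_grp m) w (\<lambda>i. ?\<psi> (b i))) = g"
    using g by (simp add: carrier_free_grp)
  moreover have "word_eval (free_grp m) w (\<lambda>i. ?\<psi> (b i)) \<in> carrier (free_grp m)"
    using b w c by (auto intro!: word_eval_closed group_free_grp)
  ultimately have "word_eval (free_grp m) w (\<lambda>i. ?\<psi> (b i)) = g"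
    by (simp add: carrier_free_grp)
  then show ?thesis
    using b c by (intro exI[of _ "\<lambda>i. ?\<psi> (b i)"]) (auto intro!: word_eval_closed group_free_grp)
qed


text \<open>Lexicographic induction on \<open>(length g, m)\<close>: killing a letter lowers
  \<open>m\<close> without lengthening \<open>g\<close>, while the double cover raises the rank to
  \<open>2 * m\<close> but strictly shortens \<open>g\<close>.\<close>

lemma value_of_residual_value:
  assumes w: "w \<in> carrier (free_grp n)"
    and base: "\<And>k. 1 \<le> k \<Longrightarrow> k \<le> n \<Longrightarrow> local_to_global n w k"
  shows "g \<in> carrier (free_grp m) \<Longrightarrow> residual_value (free_grp m) n w g \<Longrightarrow>
    \<exists>a. (\<forall>i<n. a i \<in> carrier (free_grp m)) \<and> word_eval (free_grp m) w a = g"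
proof (induction "(length g, m)" arbitrary: g m
    rule: wf_induct_rule[OF wf_lex_prod[OF wf_less_than wf_less_than]])
  case (1 g m)
  note g = \<open>g \<in> carrier (free_grp m)\<close> and res = \<open>residual_value (free_grp m) n w g\<close>
  have IH: "\<exists>a. (\<forall>i<n. a i \<in> carrier (free_grp p)) \<and> word_eval (free_grp p) w a = h"
    if "length h < length g \<or> length h = length g \<and> p < m"
      "h \<in> carrier (free_grp p)" "residual_value (free_grp p) n w h" for h p
    using "1.hyps"[of h p] that by simp
  interpret F: group "free_grp m"
    by (rule group_free_grp)
  have w': "i < n" if "i \<in> fst ` set w" for i
    using fst_set_free_grp[OF w that] .
  have g': "x < m" if "x \<in> fst ` set g" for x
    using fst_set_free_grp[OF g that] .
  have letter: "[(x, b)] \<in> carrier (free_grp k)" if "x < k" for x b k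
    using that by (simp add: carrier_free_grp reduced_Cons)
  have empty: "[] \<in> carrier (free_grp k)" for k
    by (simp add: carrier_free_grp)
  consider "m = 0" | "1 \<le> m" "m \<le> n" | x where "n < m" "x < m" "x \<notin> fst ` set g"
    | "n < m" "fst ` set g = {..<m}"
    using g' by force
  then show ?case
  proof cases
    case 1
    \<comment> \<open>Rank zero is treated apart since \<open>base\<close> starts at rank one; the
      group is trivial.\<close>
    have "word_eval (free_grp m) w (\<lambda>_. []) \<in> carrier (free_grp m)"
      by (intro word_eval_closed group_free_grp empty)
    then show ?thesis
      using g 1 empty by (intro exI[of _ "\<lambda>_. []"]) (simp add: carrier_free_grp)
  next
    case 2
    then show ?thesis
      using base[of m] g res unfolding local_to_global_iff[OF w group_free_grp] by blast
  next
    case (3 x)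
    \<comment> \<open>The letter \<open>x\<close> is killed and the last letter \<open>m - 1\<close>
      takes over its name, which keeps the alphabet an initial segment; \<open>c\<close> undoes the
      renaming. Indices from \<open>m\<close> on get empty labels because labels must lie in the
      group at every index.\<close>
    define e where "e = (\<lambda>(_::bool) i. if i = x \<or> m \<le> i then []
      else if i = m - 1 then [(x, False)] else [(i, False)])"
    define c where "c = (\<lambda>i. if m \<le> i then [] else if i = x then [(m - 1, False)] else [(i, False)])"
    have e: "e v i = [] \<or> (\<exists>j<m - 1. e v i = [(j, False)])" for v i
      using 3 by (auto simp: e_def)
    then have e_closed: "e v i \<in> carrier (free_grp (m - 1))" for v i
      using letter empty by metis
    show ?thesis
    proof (rule value_descent[where S = "{}" and t = "\<lambda>_. []", OF w' g _ e_closed])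
      show "c i \<in> carrier (free_grp m)" for i
        using 3 letter empty by (auto simp: c_def)
      show "red (word_eval (free_grp m) (e v i) c @ []) = red ([] @ [(i, False)])"
        if "i \<in> fst ` set g" for v i
      proof -
        have "i \<noteq> x" "i < m"
          using that 3 g' by blast+
        then show ?thesis
          using 3 by (auto simp: e_def c_def push_def)
      qed
      let ?h = "schreier (free_grp (m - 1)) {} e False g"
      assume "residual_value (free_grp (m - 1)) n w ?h"
      moreover have "length ?h \<le> length g"
        by (rule length_schreier[OF e])
      moreover have "?h \<in> carrier (free_grp (m - 1))"
        by (intro labelling.schreier_closed labelling.intro labelling_axioms.intro group_free_grp e_closed)
      ultimately show "\<exists>b. (\<forall>i<n. b i \<in> carrier (free_grp (m - 1))) \<and>
          word_eval (free_grp (m - 1)) w b = ?h"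
        using 3 by (intro IH) auto
    qed (use res in \<open>auto simp: residual_value_def empty\<close>)
  next
    case 4
    obtain S where S: "S \<subseteq> {..<m}" "S \<noteq> {}"
      and res_S: "\<And>N. N \<in> fin_quot_idx (free_grp m) \<Longrightarrow>
        \<exists>a. (\<forall>i<n. a i \<in> carrier (free_grp m) \<and> \<not> parity S (a i)) \<and>
          N #>\<^bsub>free_grp m\<^esub> word_eval (free_grp m) w a = N #>\<^bsub>free_grp m\<^esub> g"
      using residual_value_even[OF res 4(1) w' g] by blast
    \<comment> \<open>Every letter occurs in \<open>g\<close>, so one in \<open>S\<close> does; up
      to the first such letter the lift stays in sheet \<open>False\<close>.\<close>
    have "\<exists>l\<in>set g. fst l \<in> S"
      using S 4(2) by (metis ex_in_conv imageE subsetD)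
    from split_list_first_prop[OF this] obtain u l u' where split: "g = u @ l # u'" "fst l \<in> S" "\<forall>l\<in>set u. fst l \<notin> S"
      by blast
    obtain x0 b where l: "l = (x0, b)"
      by (cases l)
    have x0: "x0 < m"
      using split(2) S(1) l by auto
    have u_even: "\<not> parity S u"
      using split(3) by (simp add: parity_def filter_empty_conv)
    \<comment> \<open>The first letter of \<open>g\<close> that changes sheet runs along the edge \<open>x0\<close> leaving sheet \<open>b\<close>
      (backwards if \<open>b\<close>). This edge is taken as the spanning tree, so that rewriting shortens \<open>g\<close>.\<close>
    define e where "e = (\<lambda>v x. if v = b \<and> x = x0 \<or> m \<le> x then [] else [(2 * x + of_bool v, False)])"
    define t where "t v = (if v then [(x0, b)] else [])" for v
    \<comment> \<open>The index \<open>2 * x + of_bool v\<close> encodes the edge \<open>x\<close>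
      leaving sheet \<open>v\<close>, decoded by \<open>j div 2\<close> and \<open>odd j\<close>.
      The value \<open>c j\<close> is the Schreier generator of that edge: out along the tree path
      \<open>t\<close>, across the edge, and back.\<close>
    define c where "c j = (if m \<le> j div 2 then []
      else t (odd j) \<otimes>\<^bsub>free_grp m\<^esub> [(j div 2, False)] \<otimes>\<^bsub>free_grp m\<^esub>
        inv\<^bsub>free_grp m\<^esub> (t (odd j \<noteq> (j div 2 \<in> S))))" for j
    have t: "t v \<in> carrier (free_grp m)" for v
      using letter[OF x0] empty by (simp add: t_def)
    have c: "c j \<in> carrier (free_grp m)" for j
      unfolding c_def using F.m_closed F.inv_closed t letter empty by (auto simp del: mult_free_grp)
    have e: "e v x = [] \<or> (\<exists>j<2 * m. e v x = [(j, False)])" for v x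
      by (auto simp: e_def)
    then have e_closed: "e v x \<in> carrier (free_grp (2 * m))" for v x
      using letter empty by metis
    show ?thesis
    proof (rule value_descent[where S = S and t = t and c = c, OF w' g res_S e_closed])
      show "red (word_eval (free_grp m) (e v x) c @ t (v \<noteq> (x \<in> S))) = red (t v @ [(x, False)])"
        if x: "x \<in> fst ` set g" for v x
      proof (cases "v = b \<and> x = x0")
        \<comment> \<open>On the tree edge the label is empty and \<open>t\<close> absorbs the
          letter, cancelling it if \<open>b\<close> holds.\<close>
        case True
        then show ?thesis
          using split(2) l by (cases b) (auto simp: e_def t_def push_def)
      next
        case False
        have xm: "x < m"
          using g'[OF x] .
        have "c (2 * x + of_bool v) = t v \<otimes>\<^bsub>free_grp m\<^esub> [(x, False)] \<otimes>\<^bsub>free_grp m\<^esub>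
            inv\<^bsub>free_grp m\<^esub> (t (v \<noteq> (x \<in> S)))"
          using xm by (cases v) (simp_all add: c_def del: mult_free_grp)
        then have "c (2 * x + of_bool v) \<otimes>\<^bsub>free_grp m\<^esub> t (v \<noteq> (x \<in> S)) =
            t v \<otimes>\<^bsub>free_grp m\<^esub> [(x, False)]"
          using t letter[OF xm] F.m_assoc F.l_inv F.r_one F.m_closed F.inv_closed
          by (simp del: mult_free_grp one_free_grp)
        moreover have "e v x = [(2 * x + of_bool v, False)]"
          using False xm by (auto simp: e_def)
        ultimately show ?thesis
          by simp
      qed
      let ?h = "schreier (free_grp (2 * m)) S e False g"
      assume "residual_value (free_grp (2 * m)) n w ?h"
      moreover have "length ?h < length g"
        unfolding split(1) l using split(2) l u_even
        by (intro length_schreier_less[OF e]) (simp_all add: e_def)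
      moreover have "?h \<in> carrier (free_grp (2 * m))"
        by (intro labelling.schreier_closed labelling.intro labelling_axioms.intro group_free_grp e_closed)
      ultimately show "\<exists>b. (\<forall>i<n. b i \<in> carrier (free_grp (2 * m))) \<and>
          word_eval (free_grp (2 * m)) w b = ?h"
        by (intro IH) auto
    qed (use c t[of True] in \<open>auto simp: t_def\<close>)
  qed
qed

theorem mainTheorem2:
  fixes n :: nat and w :: "letter list"
  assumes "n \<ge> 1" and "w \<in> carrier (free_grp n)"
  shows "(\<forall>k\<ge>1. local_to_global n w k) \<longleftrightarrow> (\<forall>k. 1 \<le> k \<and> k \<le> n \<longrightarrow> local_to_global n w k)"
  using value_of_residual_value[OF assms(2)]
  unfolding local_to_global_iff[OF assms(2) group_free_grp] by blast

end
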